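(* Let $\mathbb{G}$ be a homogeneous Lie group of homogeneous dimension $Q$, $|\cdot|$ any homogeneous quasi-norm on $\mathbb{G}$, $1<p<\infty$ and $\alpha\in\mathbb{R}$. Then for all complex-valued $f\in C_0^\infty(\mathbb{G}\setminus\{0\})$, $$\left|\frac{Q-\alpha}{p}\right|^p\left\|\frac{f}{|x|^{\alpha/p}}\right\|_{L^p(\mathbb{G})}^p=\left\|\frac{\mathcal{R}_{|x|}f}{|x|^{\alpha/p-1}}\right\|_{L^p(\mathbb{G})}^p-\int_{\mathbb{G}}C_p\!\left(\frac{\mathcal{R}_{|x|}f}{|x|^{\alpha/p-1}},\;\frac{\mathcal{R}_{|x|}f}{|x|^{\alpha/p-1}}+\frac{Q-\alpha}{p}\frac{f}{|x|^{\alpha/p}}\right)dx.$$ Consequently $\left|\frac{Q-\alpha}{p}\right|^p\|f/|x|^{\alpha/p}\|_{L^p(\mathbb{G})}^p\le\|\mathcal{R}_{|x|}f/|x|^{\alpha/p-1}\|_{L^p(\mathbb{G})}^p$. Moreover, if $p\ge2$, the integral of $C_p$ above vanishes only if $f(x)=|x|^{-(Q-\alpha)/p}\varphi(x/|x|)$ for some $\varphi:\mathfrak{S}\to\mathbb{C}$, which for $f\in C_0^\infty(\mathbb{G}\setminus\{0\})$ forces $f=0$; hence for $p\ge 2$ the last inequality is strict for every nonzero $f$ (the constant is not attained).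
   Context: A homogeneous Lie group is a connected simply connected (nilpotent) Lie group $\mathbb{G}$, identified with $\mathbb{R}^n$, whose Lie algebra carries dilations $D_\lambda=\exp(A\ln\lambda)$, $\lambda>0$, with $A$ diagonalisable with positive eigenvalues and each $D_\lambda$ a Lie algebra automorphism; these induce dilations $x\mapsto\lambda x$ on $\mathbb{G}$. The homogeneous dimension is $Q=\operatorname{Tr}A$, and the Haar measure $dx$ (Lebesgue measure) satisfies $\int f(\lambda x)dx=\lambda^{-Q}\int f(x)dx$. A homogeneous quasi-norm is a continuous $|\cdot|:\mathbb{G}\to[0,\infty)$ with $|x^{-1}|=|x|$, $|\lambda x|=\lambda|x|$, and $|x|=0$ iff $x=0$. $\mathfrak{S}=\{x:|x|=1\}$; there is a positive Borel measure $\sigma$ on $\mathfrak{S}$ with $\int_{\mathbb{G}}f\,dx=\int_0^\infty\int_{\mathfrak{S}}f(ry)r^{Q-1}d\sigma(y)dr$. The radial derivative is $\mathcal{R}_{|x|}f(x)=\frac{d}{dr}f(ry)$ evaluated at $r=|x|$, $y=x/|x|$. For complex $\xi,\eta$, $C_p(\xi,\eta):=|\xi|^p-|\xi-\eta|^p-p|\xi-\eta|^{p-2}\operatorname{Re}((\xi-\eta)\overline{\eta})$ (last term $0$ when $\xi=\eta$). *)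

theory Defs
  imports "HOL-Analysis.Analysis"
begin

coinductive smooth_fun :: "('a::euclidean_space \<Rightarrow> 'b::real_normed_vector) \<Rightarrow> bool" where
  "(\<forall>x. f differentiable (at x)) \<Longrightarrow>
   (\<forall>b\<in>Basis. smooth_fun (\<lambda>x. frechet_derivative f (at x) b)) \<Longrightarrow> smooth_fun f"

definition C0inf_punct :: "('a::euclidean_space \<Rightarrow> complex) set" where
  "C0inf_punct = {f. smooth_fun f \<and> compact (closure {x. f x \<noteq> 0})
                    \<and> 0 \<notin> closure {x. f x \<noteq> 0}}"

text \<open>Dilations D_lambda = exp(A ln lambda), A = P diag(nu) P^-1 (diagonalisable,
  eigenvalues nu_i > 0), acting on G = R^n in exponential coordinates.\<close>
definition hdil :: "real^'n^'n \<Rightarrow> real^'n \<Rightarrow> real \<Rightarrow> real^'n \<Rightarrow> real^'n" where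
  "hdil P \<nu> t x = P *v (\<chi> i. (t powr (\<nu> $ i)) * ((matrix_inv P *v x) $ i))"

text \<open>Homogeneous dimension Q = Tr A.\<close>
definition hom_dim :: "real^'n \<Rightarrow> real" where
  "hom_dim \<nu> = (\<Sum>i\<in>UNIV. \<nu> $ i)"

text \<open>Homogeneous Lie group on R^n (exponential coordinates: identity 0, inverse -x),
  smooth group law, dilations are group automorphisms.\<close>
definition homogeneous_group :: "(real^'n \<Rightarrow> real^'n \<Rightarrow> real^'n) \<Rightarrow> real^'n^'n \<Rightarrow> real^'n \<Rightarrow> bool" where
  "homogeneous_group mul P \<nu> \<longleftrightarrow>
     (\<forall>x y z. mul (mul x y) z = mul x (mul y z)) \<and>
     (\<forall>x. mul x 0 = x \<and> mul 0 x = x) \<and>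
     (\<forall>x. mul x (- x) = 0 \<and> mul (- x) x = 0) \<and>
     smooth_fun (\<lambda>(x, y). mul x y) \<and>
     invertible P \<and> (\<forall>i. \<nu> $ i > 0) \<and>
     (\<forall>t>0. \<forall>x y. hdil P \<nu> t (mul x y) = mul (hdil P \<nu> t x) (hdil P \<nu> t y))"

definition homogeneous_quasi_norm :: "real^'n^'n \<Rightarrow> real^'n \<Rightarrow> (real^'n \<Rightarrow> real) \<Rightarrow> bool" where
  "homogeneous_quasi_norm P \<nu> N \<longleftrightarrow>
     continuous_on UNIV N \<and> (\<forall>x. N x \<ge> 0) \<and> (\<forall>x. N (- x) = N x) \<and>
     (\<forall>t>0. \<forall>x. N (hdil P \<nu> t x) = t * N x) \<and> (\<forall>x. N x = 0 \<longleftrightarrow> x = 0)"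

definition radial_deriv :: "real^'n^'n \<Rightarrow> real^'n \<Rightarrow> (real^'n \<Rightarrow> real) \<Rightarrow> (real^'n \<Rightarrow> complex) \<Rightarrow> real^'n \<Rightarrow> complex" where
  "radial_deriv P \<nu> N f x =
     vector_derivative (\<lambda>r. f (hdil P \<nu> r (hdil P \<nu> (1 / N x) x))) (at (N x))"

definition Cp :: "real \<Rightarrow> complex \<Rightarrow> complex \<Rightarrow> real" where
  "Cp p \<xi> \<eta> = cmod \<xi> powr p - cmod (\<xi> - \<eta>) powr p
      - (if \<xi> = \<eta> then 0 else p * cmod (\<xi> - \<eta>) powr (p - 2) * Re ((\<xi> - \<eta>) * cnj \<eta>))"

end

theory Submission
  imports Defs
begin

text \<open>
  No polar coordinates are needed. Let \<open>A\<close> generate the dilations and let \<open>E f x\<close> be the derivative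
  of \<open>f\<close> at \<open>x\<close> in direction \<open>A x\<close>, so that the radial derivative of \<open>f\<close> is \<open>E f / |x|\<close>.
  Since the dilation by \<open>t\<close> multiplies Lebesgue measure by \<open>t\<close> to the power \<open>Q\<close>,
  the integral of \<open>|f|^p (t x) |x|^-\<alpha>\<close> is \<open>t\<close> to the power \<open>\<alpha> - Q\<close> times the integral of \<open>|f|^p |x|^-\<alpha>\<close>;
  differentiating at \<open>t = 1\<close> gives the integral of \<open>E (|f|^p) |x|^-\<alpha>\<close>, which is
  exactly the cross term of \<open>C_p\<close>. For every \<open>p > 1\<close> the function \<open>C_p (\<xi>, \<eta>)\<close> is nonnegative and
  vanishes only for \<open>\<eta> = 0\<close>, so a vanishing remainder forces the Euler equation
  \<open>E f = - (Q - \<alpha>) / p f\<close>. Its solutions are homogeneous along dilation orbits, hence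
  not compactly supported unless they are zero.
\<close>

section \<open>Linear changes of variables\<close>

lemma nn_integral_lborel_translate:
  fixes F :: "'a::euclidean_space \<Rightarrow> ennreal"
  assumes [measurable]: "F \<in> borel_measurable borel"
  shows "(\<integral>\<^sup>+x. F (c + x) \<partial>lborel) = (\<integral>\<^sup>+x. F x \<partial>lborel)"
proof -
  have "(\<integral>\<^sup>+x. F x \<partial>lborel) = (\<integral>\<^sup>+x. F x \<partial>distr lborel borel ((+) c))"
    by (simp add: lborel_distr_plus)
  also have "\<dots> = (\<integral>\<^sup>+x. F (c + x) \<partial>lborel)"
    by (rule nn_integral_distr) auto
  finally show ?thesis ..
qed

text \<open>
  Fubini proof of the uniqueness of translation-invariant measures, which avoids determinants:
  the library's \<open>measure_linear_image\<close> is restricted to well-ordered index types.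
\<close>
lemma nn_integral_lborel_linear:
  fixes T S :: "'a::euclidean_space \<Rightarrow> 'a"
  assumes T: "linear T" and TS: "\<And>x. T (S x) = x"
  obtains \<kappa> where "\<And>F. F \<in> borel_measurable borel \<Longrightarrow>
    (\<integral>\<^sup>+x. F (T x) \<partial>lborel) = \<kappa> * (\<integral>\<^sup>+x. F x \<partial>lborel)"
\<comment> \<open>The factor is the volume of the set that \<open>- T\<close> maps into the unit
  box. It appears when \<open>F\<close> and the box indicator trade places in a double
  integral.\<close>
proof (rule that[of "\<integral>\<^sup>+x. indicator (box 0 One) (- T x) \<partial>lborel"])
  fix F :: "'a \<Rightarrow> ennreal"
  assume F [measurable]: "F \<in> borel_measurable borel"
  have T_add: "T (x + y) = T x + T y" for x y
    using T by (rule linear_add)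
  have [measurable]: "T \<in> borel_measurable borel"
    using T by (intro borel_measurable_continuous_onI linear_continuous_on)
      (simp add: linear_conv_bounded_linear)
  define G :: "'a \<Rightarrow> ennreal" where "G = indicator (box 0 One)"
  have [measurable]: "G \<in> borel_measurable borel"
    unfolding G_def by measurable
  have G1: "(\<integral>\<^sup>+y. G y \<partial>lborel) = 1"
    by (simp add: G_def emeasure_lborel_box_eq)
  have "(\<integral>\<^sup>+x. F (T x) \<partial>lborel) = (\<integral>\<^sup>+y. G y * (\<integral>\<^sup>+x. F (T x) \<partial>lborel) \<partial>lborel)"
    by (simp add: nn_integral_multc G1)
  \<comment> \<open>Shifting \<open>x\<close> by \<open>S y\<close> replaces \<open>T x\<close> by
    \<open>T x + y\<close> without changing the inner integral.\<close>
  also have "\<dots> = (\<integral>\<^sup>+y. G y * (\<integral>\<^sup>+x. F (T x + y) \<partial>lborel) \<partial>lborel)"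
  proof -
    have "(\<integral>\<^sup>+x. F (T x + y) \<partial>lborel) = (\<integral>\<^sup>+x. F (T x) \<partial>lborel)" for y
      using nn_integral_lborel_translate[of "\<lambda>x. F (T x)" "S y"]
      by (simp add: T_add TS add.commute)
    then show ?thesis by simp
  qed
  also have "\<dots> = (\<integral>\<^sup>+y. (\<integral>\<^sup>+x. G y * F (T x + y) \<partial>lborel) \<partial>lborel)"
    by (simp add: nn_integral_cmult)
  also have "\<dots> = (\<integral>\<^sup>+x. (\<integral>\<^sup>+y. G y * F (T x + y) \<partial>lborel) \<partial>lborel)"
    by (rule lborel_pair.Fubini') measurable
  also have "\<dots> = (\<integral>\<^sup>+x. (\<integral>\<^sup>+y. G (y - T x) * F y \<partial>lborel) \<partial>lborel)"
  proof (rule nn_integral_cong)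
    fix x
    show "(\<integral>\<^sup>+y. G y * F (T x + y) \<partial>lborel) = (\<integral>\<^sup>+y. G (y - T x) * F y \<partial>lborel)"
      using nn_integral_lborel_translate[of "\<lambda>y. G (y - T x) * F y" "T x"] by simp
  qed
  also have "\<dots> = (\<integral>\<^sup>+y. (\<integral>\<^sup>+x. G (y - T x) * F y \<partial>lborel) \<partial>lborel)"
    by (rule lborel_pair.Fubini') measurable
  also have "\<dots> = (\<integral>\<^sup>+y. (\<integral>\<^sup>+x. G (y - T x) \<partial>lborel) * F y \<partial>lborel)"
    by (simp add: nn_integral_multc)
  \<comment> \<open>The same shift by \<open>S y\<close> now removes \<open>y\<close> from the first
    factor, so the double integral splits into a product.\<close>
  also have "\<dots> = (\<integral>\<^sup>+y. (\<integral>\<^sup>+x. G (- T x) \<partial>lborel) * F y \<partial>lborel)"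
  proof -
    have "(\<integral>\<^sup>+x. G (y - T x) \<partial>lborel) = (\<integral>\<^sup>+x. G (- T x) \<partial>lborel)" for y
      using nn_integral_lborel_translate[of "\<lambda>x. G (y - T x)" "S y"]
      by (simp add: T_add TS)
    then show ?thesis by simp
  qed
  also have "\<dots> = (\<integral>\<^sup>+x. indicator (box 0 One) (- T x) \<partial>lborel) * (\<integral>\<^sup>+y. F y \<partial>lborel)"
    by (simp add: nn_integral_cmult G_def)
  finally show "(\<integral>\<^sup>+x. F (T x) \<partial>lborel)
    = (\<integral>\<^sup>+x. indicator (box 0 One) (- T x) \<partial>lborel) * (\<integral>\<^sup>+y. F y \<partial>lborel)" .
qed

text \<open>The scaling rule \<open>lborel_affine_euclidean\<close> is indexed by
  \<open>Basis\<close>, so the proof transports the factors from coordinates to basis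
  vectors.\<close>

lemma nn_integral_lborel_diagonal:
  fixes c :: "'n::finite \<Rightarrow> real" and F :: "real^'n \<Rightarrow> ennreal"
  assumes [measurable]: "F \<in> borel_measurable borel" and c: "\<And>i. c i > 0"
  shows "(\<Prod>i\<in>UNIV. c i) * (\<integral>\<^sup>+x. F (\<chi> i. c i * x $ i) \<partial>lborel) = (\<integral>\<^sup>+x. F x \<partial>lborel)"
proof -
  define d where "d b = c (SOME i. b = axis i 1)" for b :: "real^'n"
  have d: "d (axis i 1) = c i" for i
    unfolding d_def by (simp add: axis_eq_axis)
  have B: "(Basis :: (real^'n) set) = (\<lambda>i. axis i 1) ` UNIV"
    by (auto simp: Basis_vec_def)
  have I: "inj (\<lambda>i::'n. axis i (1::real))"
    by (auto simp: inj_on_def axis_eq_axis)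
  have T: "(\<lambda>x. 0 + (\<Sum>j\<in>Basis. (d j * (x \<bullet> j)) *\<^sub>R j)) = (\<lambda>x. \<chi> i. c i * x $ i)"
  proof
    fix x :: "real^'n"
    have "(\<Sum>j\<in>UNIV. (c j * x $ j) *\<^sub>R axis j 1) $ i = c i * x $ i" for i
      by (simp add: axis_def if_distrib cong: if_cong)
    then show "0 + (\<Sum>j\<in>Basis. (d j * (x \<bullet> j)) *\<^sub>R j) = (\<chi> i. c i * x $ i)"
      by (simp add: B sum.reindex[OF I] d vec_eq_iff cart_eq_inner_axis[symmetric])
  qed
  have D: "(\<Prod>j\<in>Basis. \<bar>d j\<bar>) = (\<Prod>i\<in>UNIV. c i)"
    using c by (simp add: B prod.reindex[OF I] d less_imp_le)
  have dn: "d j \<noteq> 0" if "j \<in> Basis" for j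
    using that c by (auto simp: Basis_vec_def d) (metis less_irrefl)
  have [measurable]: "(\<lambda>x::real^'n. \<chi> i. c i * x $ i) \<in> borel_measurable borel"
    by (intro borel_measurable_continuous_onI continuous_intros)
  have "(\<integral>\<^sup>+x. F x \<partial>lborel)
    = (\<integral>\<^sup>+x. F x \<partial>density (distr lborel borel (\<lambda>x. \<chi> i. c i * x $ i)) (\<lambda>_. (\<Prod>i\<in>UNIV. c i)))"
    using lborel_affine_euclidean[of d 0, OF dn, unfolded T D] by simp
  also have "\<dots> = (\<Prod>i\<in>UNIV. c i) * (\<integral>\<^sup>+x. F (\<chi> i. c i * x $ i) \<partial>lborel)"
    by (simp add: nn_integral_density nn_integral_distr nn_integral_cmult)
  finally show ?thesis ..
qed

section \<open>Dilations\<close>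

locale dilations =
  fixes P :: "real^'n^'n" and \<nu> :: "real^'n"
  assumes invertible_P: "invertible P"
begin

abbreviation \<delta> :: "real \<Rightarrow> real^'n \<Rightarrow> real^'n" where "\<delta> \<equiv> hdil P \<nu>"

abbreviation Q :: real where "Q \<equiv> hom_dim \<nu>"

text \<open>The matrix \<open>A = P diag(\<nu>) P^-1\<close> applied to \<open>x\<close>: the
  infinitesimal generator of the dilations \<open>exp (A ln t)\<close>.\<close>

definition dil_gen :: "real^'n \<Rightarrow> real^'n" where
  "dil_gen x = P *v (\<chi> i. \<nu> $ i * (matrix_inv P *v x) $ i)"

lemma P_inv [simp]: "matrix_inv P *v (P *v x) = x" "P *v (matrix_inv P *v x) = x"
proof -
  obtain P' where "P ** P' = mat 1 \<and> P' ** P = mat 1"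
    using invertible_P by (auto simp: invertible_def)
  then have "P ** matrix_inv P = mat 1 \<and> matrix_inv P ** P = mat 1"
    unfolding matrix_inv_def by (rule someI)
  then show "matrix_inv P *v (P *v x) = x" "P *v (matrix_inv P *v x) = x"
    by (simp_all add: matrix_vector_mul_assoc)
qed

lemma hdil_zero [simp]: "\<delta> t 0 = 0"
proof -
  have "(\<chi> i. 0) = (0 :: real^'n)" by (simp add: vec_eq_iff)
  then show ?thesis by (simp add: hdil_def)
qed

lemma hdil_one [simp]: "\<delta> 1 x = x"
  by (simp add: hdil_def)

lemma hdil_hdil: "0 < s \<Longrightarrow> 0 < t \<Longrightarrow> \<delta> s (\<delta> t x) = \<delta> (s * t) x"
  by (simp add: hdil_def powr_mult mult.assoc)

lemma hdil_inverse: "0 < t \<Longrightarrow> \<delta> (1 / t) (\<delta> t x) = x" "0 < t \<Longrightarrow> \<delta> t (\<delta> (1 / t) x) = x"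
  by (simp_all add: hdil_hdil)

lemma hdil_eq_0_iff: "0 < t \<Longrightarrow> \<delta> t x = 0 \<longleftrightarrow> x = 0"
  by (metis hdil_inverse(1) hdil_zero)

lemma continuous_on_hdil:
  assumes "continuous_on S a" "continuous_on S y" "\<And>s. s \<in> S \<Longrightarrow> 0 < a s"
  shows "continuous_on S (\<lambda>s. \<delta> (a s) (y s))"
  unfolding hdil_def
  by (intro continuous_intros assms
      bounded_linear.continuous_on[OF matrix_vector_mul_bounded_linear])
    (use assms(3) in force)+

lemma measurable_hdil [measurable]: "0 < t \<Longrightarrow> \<delta> t \<in> borel_measurable borel"
  using continuous_on_hdil[of UNIV "\<lambda>_. t" "\<lambda>x. x"]
  by (intro borel_measurable_continuous_onI) simp

lemma continuous_on_dil_gen: "continuous_on S dil_gen"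
  unfolding dil_gen_def
  by (intro continuous_intros bounded_linear.continuous_on[OF matrix_vector_mul_bounded_linear])

text \<open>In the eigencoordinates of \<open>A\<close> each component is a power of
  \<open>t\<close>. Differentiating brings down \<open>\<nu> $ i / t\<close>, which is
  \<open>A / t\<close> in the original coordinates.\<close>

lemma has_vector_derivative_hdil:
  assumes "0 < t"
  shows "((\<lambda>t. \<delta> t x) has_vector_derivative (1 / t) *\<^sub>R dil_gen (\<delta> t x)) (at t)"
proof -
  let ?y = "matrix_inv P *v x"
  have "((\<lambda>t. \<chi> i. (t powr (\<nu> $ i)) * ?y $ i) has_vector_derivative
      (\<chi> i. (\<nu> $ i * t powr (\<nu> $ i - 1)) * ?y $ i)) (at t)"
    unfolding has_vector_derivative_def
    by (subst has_derivative_componentwise_within)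
      (use assms in \<open>auto simp: Basis_vec_def inner_axis has_vector_derivative_def[symmetric]
        has_real_derivative_iff_has_vector_derivative[symmetric]
        powr_diff intro!: derivative_eq_intros\<close>)
  from bounded_linear.has_vector_derivative[OF matrix_vector_mul_bounded_linear this, of P]
  have "((\<lambda>t. \<delta> t x) has_vector_derivative P *v (\<chi> i. (\<nu> $ i * t powr (\<nu> $ i - 1)) * ?y $ i)) (at t)"
    by (simp add: hdil_def)
  also have "P *v (\<chi> i. (\<nu> $ i * t powr (\<nu> $ i - 1)) * ?y $ i) = (1 / t) *\<^sub>R dil_gen (\<delta> t x)"
  proof -
    have "(\<chi> i. (\<nu> $ i * t powr (\<nu> $ i - 1)) * ?y $ i)
      = (1 / t) *\<^sub>R (\<chi> i. \<nu> $ i * (t powr (\<nu> $ i) * ?y $ i))"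
      using assms by (simp add: vec_eq_iff powr_diff)
    then show ?thesis
      by (simp add: dil_gen_def hdil_def matrix_vector_mult_scaleR)
  qed
  finally show ?thesis .
qed

text \<open>The volume factors of \<open>P\<close> and its inverse cancel, leaving only the product
  of the \<open>t powr (\<nu> $ i)\<close>, whose exponents add up to the trace
  \<open>Q\<close>.\<close>

lemma nn_integral_hdil:
  fixes F :: "real^'n \<Rightarrow> ennreal"
  assumes t: "0 < t" and F [measurable]: "F \<in> borel_measurable borel"
  shows "(\<integral>\<^sup>+x. F (\<delta> t x) \<partial>lborel) = ennreal (t powr - Q) * (\<integral>\<^sup>+x. F x \<partial>lborel)"
proof -
  have lin: "linear ((*v) P)" "linear ((*v) (matrix_inv P))"
    by simp_all
  obtain \<kappa> where \<kappa>: "\<And>F. F \<in> borel_measurable borel \<Longrightarrow>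
      (\<integral>\<^sup>+x. F (P *v x) \<partial>lborel) = \<kappa> * (\<integral>\<^sup>+x. F x \<partial>lborel)"
    using nn_integral_lborel_linear[OF lin(1) P_inv(2)] by metis
  obtain \<kappa>' where \<kappa>': "\<And>F. F \<in> borel_measurable borel \<Longrightarrow>
      (\<integral>\<^sup>+x. F (matrix_inv P *v x) \<partial>lborel) = \<kappa>' * (\<integral>\<^sup>+x. F x \<partial>lborel)"
    using nn_integral_lborel_linear[OF lin(2) P_inv(1)] by metis
  have [measurable]: "(*v) P \<in> borel_measurable borel"
    by (intro borel_measurable_continuous_onI linear_continuous_on matrix_vector_mul_bounded_linear)
  \<comment> \<open>Testing on the unit box, which has volume 1, gives the product of the two
    factors without computing either.\<close>
  have inv_\<kappa>: "\<kappa>' * \<kappa> = 1"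
  proof -
    let ?G = "indicator (box 0 One) :: real^'n \<Rightarrow> ennreal"
    have "1 = (\<integral>\<^sup>+x. ?G (P *v (matrix_inv P *v x)) \<partial>lborel)"
      by (simp add: emeasure_lborel_box_eq)
    also have "\<dots> = \<kappa>' * (\<integral>\<^sup>+x. ?G (P *v x) \<partial>lborel)"
      by (rule \<kappa>') measurable
    also have "(\<integral>\<^sup>+x. ?G (P *v x) \<partial>lborel) = \<kappa>"
      by (subst \<kappa>) (simp_all add: emeasure_lborel_box_eq)
    finally show ?thesis ..
  qed
  have [measurable]: "(\<lambda>x::real^'n. \<chi> i. t powr (\<nu> $ i) * x $ i) \<in> borel_measurable borel"
    by (intro borel_measurable_continuous_onI continuous_intros)
  let ?H = "\<lambda>x. F (P *v (\<chi> i. t powr (\<nu> $ i) * x $ i))"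
  have "(\<Prod>i\<in>UNIV. t powr (\<nu> $ i)) = t powr Q"
    using t by (simp add: hom_dim_def powr_sum)
  then have "ennreal (t powr Q) * (\<integral>\<^sup>+x. ?H x \<partial>lborel) = (\<integral>\<^sup>+x. F (P *v x) \<partial>lborel)"
    using nn_integral_lborel_diagonal[of "\<lambda>x. F (P *v x)" "\<lambda>i. t powr (\<nu> $ i)"] t by simp
  then have "ennreal (t powr - Q) * (ennreal (t powr Q) * (\<integral>\<^sup>+x. ?H x \<partial>lborel))
      = ennreal (t powr - Q) * (\<kappa> * (\<integral>\<^sup>+x. F x \<partial>lborel))"
    by (simp add: \<kappa>)
  moreover have "ennreal (t powr - Q) * ennreal (t powr Q) = 1"
    using t by (simp add: ennreal_mult'[symmetric] powr_add[symmetric])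
  ultimately have H: "(\<integral>\<^sup>+x. ?H x \<partial>lborel) = ennreal (t powr - Q) * (\<kappa> * (\<integral>\<^sup>+x. F x \<partial>lborel))"
    by (simp add: mult.assoc[symmetric])
  have "(\<integral>\<^sup>+x. F (\<delta> t x) \<partial>lborel) = (\<integral>\<^sup>+x. ?H (matrix_inv P *v x) \<partial>lborel)"
    by (simp add: hdil_def)
  also have "\<dots> = \<kappa>' * (\<integral>\<^sup>+x. ?H x \<partial>lborel)"
    by (rule \<kappa>') measurable
  also have "\<dots> = (\<kappa>' * \<kappa>) * (ennreal (t powr - Q) * (\<integral>\<^sup>+x. F x \<partial>lborel))"
    unfolding H by (simp only: mult_ac)
  finally show ?thesis by (simp add: inv_\<kappa>)
qed

text \<open>Applied to indicators, the nonnegative version identifies the push-forward of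
  \<open>lborel\<close> under \<open>\<delta> t\<close> as a constant density; the Bochner integral
  then follows from equality of the two measures.\<close>

lemma integral_hdil:
  fixes F :: "real^'n \<Rightarrow> real"
  assumes t: "0 < t" and [measurable]: "F \<in> borel_measurable borel"
  shows "(\<integral>x. F (\<delta> t x) \<partial>lborel) = t powr - Q * (\<integral>x. F x \<partial>lborel)"
proof -
  note [measurable] = measurable_hdil[OF t]
  have "distr lborel borel (\<delta> t) = density lborel (\<lambda>_. ennreal (t powr - Q))"
  proof (rule measure_eqI)
    fix A assume "A \<in> sets (distr lborel borel (\<delta> t))"
    then have [measurable]: "A \<in> sets borel" by simp
    have "emeasure (distr lborel borel (\<delta> t)) A = (\<integral>\<^sup>+x. indicator A x \<partial>distr lborel borel (\<delta> t))"
      by simp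
    also have "\<dots> = (\<integral>\<^sup>+x. indicator A (\<delta> t x) \<partial>lborel)"
      by (rule nn_integral_distr) measurable
    also have "\<dots> = ennreal (t powr - Q) * (\<integral>\<^sup>+x. indicator A x \<partial>lborel)"
      by (rule nn_integral_hdil[OF t]) measurable
    also have "\<dots> = emeasure (density lborel (\<lambda>_. ennreal (t powr - Q))) A"
      by (simp add: emeasure_density nn_integral_cmult)
    finally show "emeasure (distr lborel borel (\<delta> t)) A = \<dots>" .
  qed simp
  then have "(\<integral>x. F (\<delta> t x) \<partial>lborel) = (\<integral>x. F x \<partial>density lborel (\<lambda>_. ennreal (t powr - Q)))"
    by (simp flip: integral_distr[of "\<delta> t" lborel borel F])
  also have "\<dots> = t powr - Q * (\<integral>x. F x \<partial>lborel)"
    by (subst integral_real_density) auto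
  finally show ?thesis .
qed

end

section \<open>The remainder function and smooth functions\<close>

text \<open>Away from zeros this is the chain rule. At a zero the norm itself may fail to be
  differentiable, but \<open>cmod (\<gamma> s)\<close> is at most
  \<open>|s - t| * (1 + cmod \<gamma>')\<close> nearby, and the spare power \<open>p - 1 > 0\<close>
  drives the difference quotient to 0.\<close>

lemma has_real_derivative_cmod_powr:
  fixes \<gamma> :: "real \<Rightarrow> complex"
  assumes \<gamma>: "(\<gamma> has_vector_derivative \<gamma>') (at t)" and p: "1 < p"
  shows "((\<lambda>t. cmod (\<gamma> t) powr p) has_real_derivative
      p * cmod (\<gamma> t) powr (p - 2) * Re (\<gamma> t * cnj \<gamma>')) (at t)"
proof (cases "\<gamma> t = 0")
  case False
  have "((\<lambda>t. norm (\<gamma> t)) has_derivative (\<lambda>x. (x *\<^sub>R \<gamma>') \<bullet> sgn (\<gamma> t))) (at t)"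
    using \<gamma> False has_derivative_compose[OF _ has_derivative_norm]
    unfolding has_vector_derivative_def by blast
  then have "((\<lambda>t. norm (\<gamma> t)) has_real_derivative (\<gamma>' \<bullet> sgn (\<gamma> t))) (at t)"
    unfolding has_field_derivative_def by (rule has_derivative_eq_rhs) (simp add: fun_eq_iff)
  then have "((\<lambda>t. cmod (\<gamma> t) powr p) has_real_derivative
      p * cmod (\<gamma> t) powr (p - 1) * (\<gamma>' \<bullet> sgn (\<gamma> t))) (at t)"
    using False by (auto intro!: derivative_eq_intros simp: powr_diff)
  also have "p * cmod (\<gamma> t) powr (p - 1) * (\<gamma>' \<bullet> sgn (\<gamma> t))
      = p * cmod (\<gamma> t) powr (p - 2) * Re (\<gamma> t * cnj \<gamma>')"
  proof -
    have "\<gamma>' \<bullet> sgn (\<gamma> t) = Re (\<gamma> t * cnj \<gamma>') / cmod (\<gamma> t)"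
      using False by (simp add: inner_complex_def sgn_eq field_simps)
    moreover have "cmod (\<gamma> t) powr (p - 1) = cmod (\<gamma> t) powr (p - 2) * cmod (\<gamma> t)"
      using False powr_add[of "cmod (\<gamma> t)" "p - 2" 1] by simp
    ultimately show ?thesis using False by simp
  qed
  finally show ?thesis .
next
  \<comment> \<open>The claimed derivative is 0 here, also for \<open>p < 2\<close>, because the
    factor \<open>\<gamma> t\<close> vanishes and \<open>0 powr (p - 2)\<close> is 0.\<close>
  case True
  have lim0: "((\<lambda>s. cmod (\<gamma> s) powr (p - 1)) \<longlongrightarrow> 0) (at t)"
  proof -
    have "(\<gamma> \<longlongrightarrow> 0) (at t)"
      using has_vector_derivative_continuous[OF \<gamma>] True by (simp add: continuous_at isCont_def)
    then have "((\<lambda>s. cmod (\<gamma> s)) \<longlongrightarrow> 0) (at t)"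
      by (rule tendsto_norm_zero)
    then show ?thesis
      using p by (intro tendsto_zero_powrI[OF _ tendsto_const]) auto
  qed
  have "((\<lambda>s. norm (\<gamma> s - \<gamma> t - (s - t) *\<^sub>R \<gamma>') / norm (s - t)) \<longlongrightarrow> 0) (at t)"
    using \<gamma> by (simp add: has_vector_derivative_def has_derivative_iff_norm)
  then have bd: "\<forall>\<^sub>F s in at t. norm (\<gamma> s - (s - t) *\<^sub>R \<gamma>') / norm (s - t) < 1"
    using True by (auto dest: order_tendstoD(2)[where a = 1])
  have "((\<lambda>s. cmod (\<gamma> s) powr (p - 1) * (1 + cmod \<gamma>')) \<longlongrightarrow> 0) (at t)"
    using tendsto_mult_left_zero[OF lim0] .
  moreover have "\<forall>\<^sub>F s in at t. norm ((cmod (\<gamma> s) powr p - cmod (\<gamma> t) powr p) / (s - t))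
      \<le> cmod (\<gamma> s) powr (p - 1) * (1 + cmod \<gamma>')"
    using bd
  proof eventually_elim
    fix s
    assume *: "norm (\<gamma> s - (s - t) *\<^sub>R \<gamma>') / norm (s - t) < 1"
    show "norm ((cmod (\<gamma> s) powr p - cmod (\<gamma> t) powr p) / (s - t))
      \<le> cmod (\<gamma> s) powr (p - 1) * (1 + cmod \<gamma>')"
    proof (cases "s = t")
      case False
      have "cmod (\<gamma> s) \<le> norm (\<gamma> s - (s - t) *\<^sub>R \<gamma>') + norm ((s - t) *\<^sub>R \<gamma>')"
        using norm_triangle_ineq[of "\<gamma> s - (s - t) *\<^sub>R \<gamma>'" "(s - t) *\<^sub>R \<gamma>'"] by simp
      also have "\<dots> \<le> \<bar>s - t\<bar> * (1 + cmod \<gamma>')"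
        using * False by (simp add: divide_less_eq distrib_left)
      finally have "cmod (\<gamma> s) / \<bar>s - t\<bar> \<le> 1 + cmod \<gamma>'"
        using False by (simp add: field_simps)
      then have "cmod (\<gamma> s) powr (p - 1) * (cmod (\<gamma> s) / \<bar>s - t\<bar>) \<le> cmod (\<gamma> s) powr (p - 1) * (1 + cmod \<gamma>')"
        by (rule mult_left_mono) simp
      moreover have "cmod (\<gamma> s) powr p = cmod (\<gamma> s) powr (p - 1) * cmod (\<gamma> s)"
        using p powr_add[of "cmod (\<gamma> s)" "p - 1" 1] by (cases "\<gamma> s = 0") auto
      ultimately show ?thesis
        using True by (simp add: abs_mult)
    qed simp
  qed
  ultimately have "((\<lambda>s. (cmod (\<gamma> s) powr p - cmod (\<gamma> t) powr p) / (s - t)) \<longlongrightarrow> 0) (at t)"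
    by (rule Lim_null_comparison[rotated])
  then show ?thesis
    using True by (simp add: has_field_derivative_iff)
qed

section \<open>Strict convexity of powers and positivity of the remainder\<close>

lemma exp_add_one_self_less:
  fixes x :: real
  assumes "x \<noteq> 0"
  shows "1 + x < exp x"
proof -
  have "exp x \<noteq> 1 + x"
    using ln_eq_minus_one[of "exp x"] assms by auto
  then show ?thesis
    using exp_ge_add_one_self[of x] by linarith
qed

text \<open>The convex graph of \<open>x powr p\<close> lies above its tangent line at
  \<open>A\<close>, and strict convexity allows contact only at \<open>X = A\<close>.\<close>

lemma tangent_powr_le:
  fixes X A :: real
  assumes "0 \<le> X" "0 < A" "1 < p"
  shows "p * A powr (p - 1) * X \<le> X powr p + (p - 1) * A powr p" (is ?le)
    and "p * A powr (p - 1) * X = X powr p + (p - 1) * A powr p \<Longrightarrow> X = A"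
proof -
  have "?le \<and> (X \<noteq> A \<longrightarrow> p * A powr (p - 1) * X < X powr p + (p - 1) * A powr p)"
  proof (cases "X = 0")
    case True
    then show ?thesis using assms by simp
  next
    case False
    with assms have X: "0 < X" by simp
    define v where "v = ln (X / A)"
    have r: "X / A = exp v" "A / X = exp (- v)"
      using X assms by (simp_all add: v_def exp_minus)
    have e1: "A powr (p - 1) * X * exp ((p - 1) * v) = X powr p"
    proof -
      have "exp ((p - 1) * v) = (X / A) powr (p - 1)"
        using X assms by (simp add: powr_def v_def)
      then show ?thesis
        using X assms by (simp add: powr_divide powr_diff)
    qed
    have e2: "A powr (p - 1) * X * exp (- v) = A powr p"
      using X assms by (simp add: r(2)[symmetric] powr_diff)
    have pos: "0 < A powr (p - 1) * X"
      using X assms by simp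
    \<comment> \<open>Dividing by \<open>A powr (p - 1) * X\<close> reduces the claim to two instances of \<open>1 + y \<le> exp y\<close>.\<close>
    have id: "X powr p + (p - 1) * A powr p - p * A powr (p - 1) * X
      = (A powr (p - 1) * X) * (exp ((p - 1) * v) + (p - 1) * exp (- v) - p)"
      unfolding e1[symmetric] e2[symmetric] by (simp add: algebra_simps)
    have le: "1 + (p - 1) * v \<le> exp ((p - 1) * v)" "(p - 1) * (1 + - v) \<le> (p - 1) * exp (- v)"
      using assms exp_ge_add_one_self[of "- v"] by (intro exp_ge_add_one_self mult_left_mono; linarith)+
    then have "0 \<le> exp ((p - 1) * v) + (p - 1) * exp (- v) - p"
      by (simp add: algebra_simps)
    then have ?le
      using id pos by (smt (verit) mult_nonneg_nonneg)
    moreover have "p * A powr (p - 1) * X < X powr p + (p - 1) * A powr p" if "X \<noteq> A"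
    proof -
      have "v \<noteq> 0"
        using that X assms by (simp add: v_def)
      then have "1 + (p - 1) * v < exp ((p - 1) * v)"
        using assms by (intro exp_add_one_self_less) simp
      with le have "0 < exp ((p - 1) * v) + (p - 1) * exp (- v) - p"
        by (simp add: algebra_simps)
      then show ?thesis
        using id pos by (smt (verit) mult_pos_pos)
    qed
    ultimately show ?thesis by blast
  qed
  then show ?le "p * A powr (p - 1) * X = X powr p + (p - 1) * A powr p \<Longrightarrow> X = A"
    by auto
qed

text \<open>Here \<open>\<xi> - \<eta>\<close> is \<open>- c * w\<close>, so the remainder separates
  into pure powers of \<open>z\<close> and \<open>w\<close> and a single mixed term, the one whose
  integral the scaling argument computes.\<close>

lemma Cp_eq:
  assumes "1 < p"
  shows "Cp p z (z + of_real c * w) = cmod z powr p + (p - 1) * \<bar>c\<bar> powr p * cmod w powr p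
    + p * c * \<bar>c\<bar> powr (p - 2) * (cmod w powr (p - 2) * Re (w * cnj z))"
proof (cases "of_real c * w = 0")
  case True
  then show ?thesis using assms by (auto simp: Cp_def)
next
  case False
  have n: "cmod (- (of_real c * w)) = \<bar>c\<bar> * cmod w"
    by (simp add: norm_mult)
  have "Re (- (of_real c * w) * cnj (z + of_real c * w)) = - c * Re (w * cnj z) - (\<bar>c\<bar> * cmod w)\<^sup>2"
    by (simp add: cmod_power2 power_mult_distrib algebra_simps power2_eq_square)
       (simp add: cmod_def algebra_simps power2_eq_square)
  moreover have "(\<bar>c\<bar> * cmod w) powr (p - 2) * (\<bar>c\<bar> * cmod w)\<^sup>2 = (\<bar>c\<bar> * cmod w) powr p"
    using False powr_add[of "\<bar>c\<bar> * cmod w" "p - 2" 2] by (simp add: powr_numeral)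
  ultimately show ?thesis
    using False unfolding Cp_def
    by (simp add: norm_mult powr_mult algebra_simps)
qed

text \<open>For nonzero \<open>a = \<xi> - \<eta>\<close> the remainder is the gap in the tangent
  inequality plus a positive multiple of the Cauchy-Schwarz gap
  \<open>|a| |\<xi>| - Re (a * cnj \<xi>)\<close>. If both gaps vanish, \<open>a\<close> and
  \<open>\<xi>\<close> have equal length and direction, so they coincide.\<close>

lemma Cp_nonneg_and_eq_0_iff:
  assumes p: "1 < p"
  shows Cp_nonneg: "0 \<le> Cp p \<xi> \<eta>" and Cp_eq_0_iff: "Cp p \<xi> \<eta> = 0 \<longleftrightarrow> \<eta> = 0"
proof -
  define a where "a = \<xi> - \<eta>"
  have "0 \<le> Cp p \<xi> \<eta> \<and> (Cp p \<xi> \<eta> = 0 \<longrightarrow> \<eta> = 0)"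
  proof (cases "a = 0")
    case True
    then show ?thesis by (simp add: Cp_def a_def)
  next
    case False
    let ?A = "cmod a" and ?X = "cmod \<xi>" and ?R = "Re (a * cnj \<xi>)"
    have Re_eq: "Re (a * cnj \<eta>) = ?R - ?A\<^sup>2"
      unfolding a_def cmod_power2 by (simp add: power2_eq_square algebra_simps)
    have pw: "?A powr (p - 2) * ?A\<^sup>2 = ?A powr p" "?A powr (p - 2) * ?A = ?A powr (p - 1)"
      using False powr_add[of ?A "p - 2" 2] powr_add[of ?A "p - 2" 1] by (simp_all add: powr_numeral)
    have "p * ?A powr (p - 2) * Re (a * cnj \<eta>) = p * (?A powr (p - 2) * ?R - ?A powr p)"
      by (simp only: Re_eq right_diff_distrib mult.assoc pw(1))
    then have "Cp p \<xi> \<eta> = ?X powr p - ?A powr p - p * (?A powr (p - 2) * ?R - ?A powr p)"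
      using False unfolding Cp_def a_def by simp
    also have "\<dots> = (?X powr p + (p - 1) * ?A powr p - p * ?A powr (p - 1) * ?X)
      + p * ?A powr (p - 2) * (?A * ?X - ?R)"
      unfolding pw(2)[symmetric] by (simp add: algebra_simps)
    finally have eq: "Cp p \<xi> \<eta> = (?X powr p + (p - 1) * ?A powr p - p * ?A powr (p - 1) * ?X)
      + p * ?A powr (p - 2) * (?A * ?X - ?R)" .
    have R: "?R \<le> ?A * ?X"
      using complex_Re_le_cmod[of "a * cnj \<xi>"] by (simp add: norm_mult)
    note T = tangent_powr_le[of ?X ?A p]
    have T1: "0 \<le> ?X powr p + (p - 1) * ?A powr p - p * ?A powr (p - 1) * ?X"
      using T(1) False p by simp
    have R1: "0 \<le> p * ?A powr (p - 2) * (?A * ?X - ?R)"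
      using R p by simp
    have "\<eta> = 0" if "Cp p \<xi> \<eta> = 0"
    proof -
      have "?X = ?A"
        using T1 R1 eq that T(2) False p by simp
      moreover have "?R = ?A * ?X"
        using T1 R1 eq that False p by (auto simp: add_nonneg_eq_0_iff)
      moreover have "(cmod (\<xi> - a))\<^sup>2 = ?X\<^sup>2 + ?A\<^sup>2 - 2 * ?R"
        unfolding cmod_power2 by (simp add: power2_eq_square algebra_simps)
      ultimately have "(cmod (\<xi> - a))\<^sup>2 = 0"
        by (simp only: power2_eq_square)
      then show ?thesis by (simp add: a_def)
    qed
    with T1 R1 eq show ?thesis by auto
  qed
  moreover have "Cp p \<xi> 0 = 0" by (simp add: Cp_def)
  ultimately show "0 \<le> Cp p \<xi> \<eta>" "Cp p \<xi> \<eta> = 0 \<longleftrightarrow> \<eta> = 0" by auto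
qed

section \<open>Continuity of derivatives of smooth functions\<close>

lemma smooth_fun_differentiable: "smooth_fun f \<Longrightarrow> f differentiable (at x)"
  by (auto elim: smooth_fun.cases)

text \<open>Smoothness speaks of derivatives in the fixed basis directions; expanding the variable
  direction \<open>v x\<close> in the basis reduces to these.\<close>

lemma continuous_on_frechet_derivative_smooth_fun:
  assumes f: "smooth_fun f" and v: "continuous_on UNIV v"
  shows "continuous_on UNIV (\<lambda>x. frechet_derivative f (at x) (v x))"
proof -
  have "frechet_derivative f (at x) (v x) = (\<Sum>b\<in>Basis. (v x \<bullet> b) *\<^sub>R frechet_derivative f (at x) b)" for x
  proof -
    have lin: "linear (frechet_derivative f (at x))"
      using smooth_fun_differentiable[OF f] frechet_derivative_works has_derivative_linear by blast
    have "frechet_derivative f (at x) (v x) = frechet_derivative f (at x) (\<Sum>b\<in>Basis. (v x \<bullet> b) *\<^sub>R b)"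
      by (simp add: euclidean_representation)
    then show ?thesis
      by (simp add: linear_sum[OF lin] linear_scale[OF lin])
  qed
  moreover have "continuous_on UNIV (\<lambda>x. frechet_derivative f (at x) b)" if "b \<in> Basis" for b
  proof -
    have "smooth_fun (\<lambda>x. frechet_derivative f (at x) b)"
      using f that by (auto elim: smooth_fun.cases)
    then show ?thesis
      by (simp add: continuous_on_eq_continuous_at differentiable_imp_continuous_within
          smooth_fun_differentiable)
  qed
  ultimately show ?thesis
    by (auto intro!: continuous_intros v)
qed

section \<open>Test functions away from the origin\<close>

text \<open>The weight \<open>w\<close> may be singular at \<open>a\<close>, but the product is
  continuous on the two open sets \<open>- {a}\<close> and \<open>- K\<close>, which cover the
  space.\<close>

lemma continuous_on_mult_vanishing_near_0:
  fixes F w :: "'a::t1_space \<Rightarrow> 'b::real_normed_algebra"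
  assumes F: "continuous_on UNIV F" and w: "continuous_on (- {a}) w"
    and K: "closed K" "a \<notin> K" "\<And>x. x \<notin> K \<Longrightarrow> F x = 0"
  shows "continuous_on UNIV (\<lambda>x. F x * w x)"
proof -
  have "continuous_on (- {a} \<union> - K) (\<lambda>x. F x * w x)"
  proof (rule continuous_on_open_Un)
    show "continuous_on (- {a}) (\<lambda>x. F x * w x)"
      by (intro continuous_intros w continuous_on_subset[OF F]) auto
    show "continuous_on (- K) (\<lambda>x. F x * w x)"
      by (rule continuous_on_eq[of _ "\<lambda>_. 0"]) (auto simp: K(3))
  qed (use K(1) in auto)
  moreover have "- {a} \<union> - K = UNIV" using K(2) by auto
  ultimately show ?thesis by simp
qed

lemma continuous_on_norm_powr:
  fixes F :: "'a::topological_space \<Rightarrow> 'b::real_normed_vector"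
  assumes "continuous_on S F" "0 < p"
  shows "continuous_on S (\<lambda>x. norm (F x) powr p)"
  by (intro continuous_on_powr' continuous_intros assms) (use assms in auto)

lemma integrable_continuous_compact_support:
  fixes F :: "'a::euclidean_space \<Rightarrow> 'b::{banach, second_countable_topology}"
  assumes "continuous_on UNIV F" "compact K" "\<And>x. x \<notin> K \<Longrightarrow> F x = 0"
  shows "integrable lborel F"
proof -
  have "integrable lborel (\<lambda>x. indicator K x *\<^sub>R F x)"
    using assms by (intro borel_integrable_compact continuous_on_subset[OF assms(1)]) auto
  also have "(\<lambda>x. indicator K x *\<^sub>R F x) = F"
    using assms(3) by (auto simp: indicator_def fun_eq_iff)
  finally show ?thesis .
qed

text \<open>The nonvanishing set is open, and a nonempty open set is never a null set.\<close>

lemma continuous_AE_lborel_zero: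
  fixes F :: "'a::euclidean_space \<Rightarrow> 'b::real_normed_vector"
  assumes F: "continuous_on UNIV F" and AE: "AE x in lborel. F x = 0"
  shows "F x = 0"
proof (rule ccontr)
  assume "F x \<noteq> 0"
  have op: "open {x. F x \<noteq> 0}"
    by (rule open_Collect_neq[OF F continuous_on_const])
  then have "emeasure lborel {x. F x \<noteq> 0} = 0"
    using AE by (subst (asm) AE_iff_measurable[OF _ refl]) (auto simp: borel_open)
  then have "{x. F x \<noteq> 0} \<in> null_sets lebesgue"
    using op by (auto simp: null_sets_def borel_open)
  then have "negligible {x. F x \<noteq> 0}"
    by (simp add: negligible_iff_null_sets)
  with op \<open>F x \<noteq> 0\<close> show False
    using open_not_negligible by blast
qed

section \<open>Homogeneous quasi-norms\<close>

locale quasi_normed_dilations = dilations P \<nu>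
  for P :: "real^'n^'n" and \<nu> :: "real^'n" +
  fixes N :: "real^'n \<Rightarrow> real"
  assumes quasi_norm: "homogeneous_quasi_norm P \<nu> N"
begin

lemma continuous_quasi_norm: "continuous_on S N"
  and quasi_norm_nonneg: "0 \<le> N x"
  and quasi_norm_hdil: "0 < t \<Longrightarrow> N (\<delta> t x) = t * N x"
  and quasi_norm_eq_0_iff: "N x = 0 \<longleftrightarrow> x = 0"
  using quasi_norm continuous_on_subset by (auto simp: homogeneous_quasi_norm_def)

lemma quasi_norm_pos: "x \<noteq> 0 \<Longrightarrow> 0 < N x"
  using quasi_norm_nonneg[of x] quasi_norm_eq_0_iff[of x] by simp

lemma continuous_on_quasi_norm_powr: "continuous_on (- {0}) (\<lambda>x. N x powr a)"
  by (intro continuous_intros continuous_quasi_norm) (auto simp: quasi_norm_eq_0_iff)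

lemma measurable_quasi_norm [measurable]: "N \<in> borel_measurable borel"
  by (intro borel_measurable_continuous_onI continuous_quasi_norm)

end

section \<open>A test function and its Euler derivative\<close>

locale punctured_test_function = quasi_normed_dilations P \<nu> N
  for P :: "real^'n^'n" and \<nu> :: "real^'n" and N :: "real^'n \<Rightarrow> real" +
  fixes f :: "real^'n \<Rightarrow> complex"
  assumes test: "f \<in> C0inf_punct"
begin

definition K :: "(real^'n) set" where "K = closure {x. f x \<noteq> 0}"

definition Ef :: "real^'n \<Rightarrow> complex" where
  "Ef x = frechet_derivative f (at x) (dil_gen x)"

lemma compact_K: "compact K" and zero_notin_K: "0 \<notin> K" and smooth_f: "smooth_fun f"
  using test by (auto simp: C0inf_punct_def K_def)

lemma f_outside: "x \<notin> K \<Longrightarrow> f x = 0"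
  using closure_subset[of "{x. f x \<noteq> 0}"] by (auto simp: K_def)

lemma differentiable_f: "f differentiable (at x)"
  using smooth_fun_differentiable[OF smooth_f] .

lemma continuous_f: "continuous_on S f"
  using differentiable_f differentiable_imp_continuous_within
  by (metis continuous_at_imp_continuous_on)

lemma continuous_Ef: "continuous_on UNIV Ef"
  unfolding Ef_def
  by (intro continuous_on_frechet_derivative_smooth_fun smooth_f continuous_on_dil_gen)

lemma measurable_f [measurable]: "f \<in> borel_measurable borel"
  by (intro borel_measurable_continuous_onI continuous_f)

lemma measurable_Ef [measurable]: "Ef \<in> borel_measurable borel"
  by (intro borel_measurable_continuous_onI continuous_Ef)

lemma Ef_outside: "x \<notin> K \<Longrightarrow> Ef x = 0"
proof -
  assume x: "x \<notin> K"
  have "((\<lambda>_. 0) has_derivative (\<lambda>_. 0)) (at x)" by simp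
  then have "(f has_derivative (\<lambda>_. 0)) (at x)"
    by (rule has_derivative_transform_within_open[of _ _ _ _ "- K"]) (use x f_outside compact_imp_closed[OF compact_K] in auto)
  then have "frechet_derivative f (at x) = (\<lambda>_. 0)"
    using frechet_derivative_at by metis
  then show ?thesis by (simp add: Ef_def)
qed

lemma has_vector_derivative_f_hdil:
  assumes "0 < t"
  shows "((\<lambda>t. f (\<delta> t x)) has_vector_derivative (1 / t) *\<^sub>R Ef (\<delta> t x)) (at t)"
proof -
  have f': "(f has_derivative frechet_derivative f (at (\<delta> t x))) (at (\<delta> t x))"
    using differentiable_f frechet_derivative_works by blast
  have "((\<lambda>t. f (\<delta> t x)) has_vector_derivative
      frechet_derivative f (at (\<delta> t x)) ((1 / t) *\<^sub>R dil_gen (\<delta> t x))) (at t)"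
    using vector_derivative_diff_chain_within[OF has_vector_derivative_hdil[OF assms], of f _ x]
      has_derivative_at_withinI[OF f'] by (auto simp: o_def)
  then show ?thesis
    by (simp add: Ef_def linear_scale[OF has_derivative_linear[OF f']])
qed

text \<open>The radial derivative follows the orbit of the projection of \<open>x\<close> to the
  unit sphere. This orbit reaches \<open>x\<close> at parameter \<open>N x\<close>, where the flow
  equation contributes the factor \<open>1 / N x\<close>.\<close>

lemma radial_deriv_eq:
  assumes "x \<noteq> 0"
  shows "radial_deriv P \<nu> N f x = Ef x / of_real (N x)"
proof -
  have N: "0 < N x" using quasi_norm_pos[OF assms] .
  have "((\<lambda>r. f (\<delta> r (\<delta> (1 / N x) x))) has_vector_derivative
      (1 / N x) *\<^sub>R Ef (\<delta> (N x) (\<delta> (1 / N x) x))) (at (N x))"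
    by (rule has_vector_derivative_f_hdil[OF N])
  then show ?thesis
    using N by (simp add: radial_deriv_def vector_derivative_at hdil_inverse(2)
        scaleR_conv_of_real)
qed

text \<open>Differentiating the scaling law of the weighted integral at \<open>t = 1\<close> gives
  the second claim. Dominated convergence along a sequence of difference quotients justifies this
  and yields integrability.\<close>

lemma integrable_integral_euler:
  fixes p \<alpha> :: real
  assumes p: "1 < p"
  defines "D \<equiv> \<lambda>x. cmod (f x) powr (p - 2) * Re (f x * cnj (Ef x)) * N x powr - \<alpha>"
  shows "integrable lborel D"
    and "p * (\<integral>x. D x \<partial>lborel) = (\<alpha> - Q) * (\<integral>x. cmod (f x) powr p * N x powr - \<alpha> \<partial>lborel)"
proof -
  define u where "u x = cmod (f x) powr p" for x
  define u' where "u' x = p * cmod (f x) powr (p - 2) * Re (f x * cnj (Ef x))" for x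
  define I where "I = (\<integral>x. u x * N x powr - \<alpha> \<partial>lborel)"
  define t where "t n = 1 + 1 / real (Suc n)" for n
  define s where "s n x = (u (\<delta> (t n) x) - u x) / (t n - 1) * N x powr - \<alpha>" for n x
  have t: "1 < t n" "t n \<le> 2" "0 < t n" for n
    by (auto simp: t_def add_pos_pos)
  have t_lim: "t \<longlonglongrightarrow> 1"
    unfolding t_def using tendsto_add[OF tendsto_const LIMSEQ_inverse_real_of_nat, of "1::real"]
    by (simp add: inverse_eq_divide)
  have t_at: "filterlim t (at 1) sequentially"
    using t_lim t(1) by (auto simp: filterlim_at less_imp_neq[symmetric])
  have [measurable]: "cnj \<in> borel_measurable borel"
    by (intro borel_measurable_continuous_onI continuous_intros)
  have [measurable]: "u \<in> borel_measurable borel" "u' \<in> borel_measurable borel"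
    unfolding u_def u'_def by measurable
  have deriv: "((\<lambda>t. u (\<delta> t x)) has_real_derivative u' (\<delta> t x) / t) (at t)" if "0 < t" for t x
    unfolding u_def u'_def
    by (rule DERIV_cong[OF has_real_derivative_cmod_powr[OF has_vector_derivative_f_hdil[OF that] p]])
      simp
  have u_int: "integrable lborel (\<lambda>x. u x * N x powr - \<alpha>)"
  proof (rule integrable_continuous_compact_support[OF _ compact_K])
    show "continuous_on UNIV (\<lambda>x. u x * N x powr - \<alpha>)"
      unfolding u_def using p
      by (intro continuous_on_mult_vanishing_near_0[OF _ continuous_on_quasi_norm_powr
            compact_imp_closed[OF compact_K] zero_notin_K] continuous_on_norm_powr continuous_f)
        (auto simp: f_outside)
  qed (simp add: u_def f_outside)
  \<comment> \<open>For \<open>p < 2\<close> the factor \<open>cmod (f x) powr (p - 2)\<close> can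
    blow up near zeros of \<open>f\<close>. The inner product supplies one more power of
    \<open>cmod (f x)\<close>, and \<open>p - 1 > 0\<close> gives a continuous bound that vanishes
    outside \<open>K\<close>.\<close>
  obtain M where M: "\<And>x. \<bar>u' x\<bar> \<le> M"
  proof -
    let ?B = "\<lambda>x. p * cmod (f x) powr (p - 1) * cmod (Ef x)"
    have "continuous_on UNIV ?B"
      using p by (intro continuous_intros continuous_on_norm_powr continuous_f continuous_Ef) auto
    then have "bounded (?B ` K)"
      by (intro compact_imp_bounded compact_continuous_image compact_K) (rule continuous_on_subset, auto)
    then obtain M where M: "\<And>x. x \<in> K \<Longrightarrow> \<bar>?B x\<bar> \<le> M"
      by (auto simp: bounded_iff)
    have "\<bar>u' x\<bar> \<le> \<bar>?B x\<bar>" for x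
    proof -
      have "\<bar>Re (f x * cnj (Ef x))\<bar> \<le> cmod (f x) * cmod (Ef x)"
        using abs_Re_le_cmod[of "f x * cnj (Ef x)"] by (simp add: norm_mult)
      then have "p * cmod (f x) powr (p - 2) * \<bar>Re (f x * cnj (Ef x))\<bar>
          \<le> p * cmod (f x) powr (p - 2) * (cmod (f x) * cmod (Ef x))"
        using p by (intro mult_left_mono) auto
      also have "\<dots> = ?B x"
        using powr_add[of "cmod (f x)" "p - 2" 1] by (cases "f x = 0") auto
      finally show ?thesis using p by (simp add: u'_def abs_mult)
    qed
    moreover have "\<bar>?B x\<bar> \<le> max M 0" for x
      using M[of x] by (cases "x \<in> K") (simp_all add: le_max_iff_disj f_outside)
    ultimately have "\<bar>u' x\<bar> \<le> max M 0" for x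
      by (rule order_trans)
    then show ?thesis using that by blast
  qed
  \<comment> \<open>A compact set away from 0 that holds every point carried into \<open>K\<close>
    by some dilation with factor in \<open>[1, 2]\<close>. All difference quotients vanish outside
    it, so they share one dominating function.\<close>
  define K' where "K' = (\<lambda>(r, x). \<delta> r x) ` ({1/2..1} \<times> K)"
  have K': "compact K'"
    unfolding K'_def case_prod_unfold
    by (intro compact_continuous_image compact_Times compact_K compact_Icc continuous_on_hdil
        continuous_intros) auto
  have zero_K': "0 \<notin> K'"
    using zero_notin_K by (auto simp: K'_def hdil_eq_0_iff)
  have in_K': "x \<in> K'" if "\<delta> r x \<in> K" "1 \<le> r" "r \<le> 2" for r x
  proof -
    have "x = (\<lambda>(r, x). \<delta> r x) (1 / r, \<delta> r x)" "1 / r \<in> {1/2..1}"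
      using that by (auto simp: hdil_inverse field_simps)
    then show ?thesis using that unfolding K'_def by blast
  qed
  define w where "w x = indicator K' x *\<^sub>R (M * N x powr - \<alpha>)" for x
  have w_int: "integrable lborel w"
    unfolding w_def using zero_K'
    by (intro borel_integrable_compact K' continuous_intros continuous_on_subset[OF continuous_on_quasi_norm_powr]) auto
  have s_bound: "norm (s n x) \<le> w x" for n x
  proof (cases "x \<in> K'")
    case True
    \<comment> \<open>The mean value theorem expresses the quotient by \<open>u'\<close> at an
      intermediate factor \<open>z > 1\<close>, and dividing by \<open>z\<close> only lowers the
      bound.\<close>
    have "\<exists>z. 1 < z \<and> z < t n \<and> u (\<delta> (t n) x) - u (\<delta> 1 x) = (t n - 1) * (u' (\<delta> z x) / z)"
      using t by (intro MVT2) (auto intro!: deriv)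
    then obtain z where z: "1 < z" "u (\<delta> (t n) x) - u x = (t n - 1) * (u' (\<delta> z x) / z)"
      by auto
    have "\<bar>(u (\<delta> (t n) x) - u x) / (t n - 1)\<bar> = \<bar>u' (\<delta> z x)\<bar> / z"
      using z t(1)[of n] by simp
    also have "\<dots> \<le> \<bar>u' (\<delta> z x)\<bar>"
      using z(1) mult_right_mono[of 1 z "\<bar>u' (\<delta> z x)\<bar>"] by (simp add: field_simps)
    also have "\<dots> \<le> M" by (rule M)
    finally have "\<bar>(u (\<delta> (t n) x) - u x) / (t n - 1)\<bar> * N x powr - \<alpha> \<le> M * N x powr - \<alpha>"
      by (rule mult_right_mono) simp
    then show ?thesis
      using True by (simp add: s_def w_def abs_mult)
  next
    case False
    then have "f (\<delta> (t n) x) = 0" "f x = 0"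
      using in_K'[of "t n" x] in_K'[of 1 x] t[of n] f_outside by (auto simp: less_imp_le)
    then show ?thesis using False by (simp add: s_def w_def u_def)
  qed
  have s_meas: "s n \<in> borel_measurable lborel" for n
  proof -
    note [measurable] = measurable_hdil[OF t(3)]
    show ?thesis unfolding s_def by measurable
  qed
  have s_lim: "(\<lambda>n. s n x) \<longlonglongrightarrow> u' x * N x powr - \<alpha>" for x
  proof -
    have "((\<lambda>r. (u (\<delta> r x) - u x) / (r - 1)) \<longlongrightarrow> u' x) (at 1)"
      using deriv[of 1 x] by (simp add: has_field_derivative_iff)
    from filterlim_compose[OF this t_at] show ?thesis
      unfolding s_def by (intro tendsto_mult_right)
  qed
  \<comment> \<open>The open first slot is measurability of the limit function, left to each
    use.\<close>
  note dom = _ s_meas w_int AE_I2[OF s_lim] AE_I2[OF s_bound]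
  have int: "integrable lborel (\<lambda>x. u' x * N x powr - \<alpha>)"
    by (rule integrable_dominated_convergence[OF dom]) measurable
  have lim: "(\<lambda>n. integral\<^sup>L lborel (s n)) \<longlonglongrightarrow> (\<integral>x. u' x * N x powr - \<alpha> \<partial>lborel)"
    by (rule integral_dominated_convergence[OF dom]) measurable
  have s_integral: "integral\<^sup>L lborel (s n) = (t n powr (\<alpha> - Q) - 1) / (t n - 1) * I" for n
  proof -
    \<comment> \<open>Rewriting \<open>N x\<close> through \<open>\<delta> (1 / t n)\<close> makes
      the integrand a function of \<open>\<delta> (t n) x\<close>: the weight contributes
      \<open>t n powr \<alpha>\<close> and the measure \<open>t n powr - Q\<close>.\<close>
    let ?F = "\<lambda>x. u x * N (\<delta> (1 / t n) x) powr - \<alpha>"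
    have F: "?F x = t n powr \<alpha> * (u x * N x powr - \<alpha>)" for x
      using t(3)[of n] quasi_norm_nonneg[of x]
      by (simp add: quasi_norm_hdil powr_divide powr_minus field_simps)
    have split: "u (\<delta> (t n) x) * N x powr - \<alpha> = (t n - 1) * s n x + u x * N x powr - \<alpha>" for x
    proof -
      have "(t n - 1) * s n x = (u (\<delta> (t n) x) - u x) * N x powr - \<alpha>"
        using t(1)[of n] by (simp add: s_def)
      then show ?thesis by (simp add: left_diff_distrib)
    qed
    have "(t n - 1) * integral\<^sup>L lborel (s n) + I = (\<integral>x. u (\<delta> (t n) x) * N x powr - \<alpha> \<partial>lborel)"
      unfolding split I_def using integrable_dominated_convergence2[OF dom] u_int by simp
    also have "\<dots> = (\<integral>x. ?F (\<delta> (t n) x) \<partial>lborel)"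
      using t(3)[of n] by (simp add: hdil_inverse)
    also have "\<dots> = t n powr - Q * (\<integral>x. ?F x \<partial>lborel)"
      using measurable_hdil[of "1 / t n"] t(3)[of n] by (intro integral_hdil) simp_all
    also have "\<dots> = t n powr (\<alpha> - Q) * I"
      unfolding F I_def using powr_add[of "t n" "- Q" \<alpha>] by simp
    finally show ?thesis
      using t(1)[of n] by (simp add: field_simps)
  qed
  have "(\<lambda>n. (t n powr (\<alpha> - Q) - 1) / (t n - 1) * I) \<longlonglongrightarrow> (\<alpha> - Q) * I"
  proof -
    have "((\<lambda>r. r powr (\<alpha> - Q)) has_real_derivative (\<alpha> - Q)) (at 1)"
      by (auto intro!: derivative_eq_intros)
    then have "((\<lambda>r. (r powr (\<alpha> - Q) - 1) / (r - 1)) \<longlongrightarrow> \<alpha> - Q) (at 1)"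
      by (simp add: has_field_derivative_iff)
    from filterlim_compose[OF this t_at] show ?thesis
      by (intro tendsto_mult_right)
  qed
  with lim have eq: "(\<integral>x. u' x * N x powr - \<alpha> \<partial>lborel) = (\<alpha> - Q) * I"
    unfolding s_integral by (rule LIMSEQ_unique)
  have D: "u' x * N x powr - \<alpha> = p * D x" for x
    by (simp add: u'_def D_def)
  show "integrable lborel D"
    using int p unfolding D by simp
  show "p * (\<integral>x. D x \<partial>lborel) = (\<alpha> - Q) * (\<integral>x. cmod (f x) powr p * N x powr - \<alpha> \<partial>lborel)"
    using eq unfolding D I_def u_def by simp
qed


text \<open>In the integrated remainder the scaling identity turns the mixed term into
  \<open>- p * |c|^p\<close> times the integral of \<open>|g|^p\<close>; together with the
  coefficient \<open>(p - 1) * |c|^p\<close> this leaves exactly \<open>- |c|^p\<close>. The third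
  claim says that a vanishing remainder makes \<open>f\<close> homogeneous of degree
  \<open>- c\<close>.\<close>

lemma hardy_identity:
  fixes p \<alpha> t :: real
  assumes p: "1 < p"
  defines "c \<equiv> (Q - \<alpha>) / p"
  defines "g \<equiv> \<lambda>x. f x / of_real (N x powr (\<alpha> / p))"
  defines "h \<equiv> \<lambda>x. radial_deriv P \<nu> N f x / of_real (N x powr (\<alpha> / p - 1))"
  shows "integrable lborel (\<lambda>x. Cp p (h x) (h x + of_real c * g x))"
    and "\<bar>c\<bar> powr p * (\<integral>x. cmod (g x) powr p \<partial>lborel)
      = (\<integral>x. cmod (h x) powr p \<partial>lborel) - (\<integral>x. Cp p (h x) (h x + of_real c * g x) \<partial>lborel)"
    and "(\<integral>x. Cp p (h x) (h x + of_real c * g x) \<partial>lborel) = 0 \<Longrightarrow> 0 < t \<Longrightarrow>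
      of_real (t powr c) * f (\<delta> t x) = f x"
proof -
  \<comment> \<open>The common weight of \<open>g\<close> and \<open>h\<close>: dividing by
    \<open>N x\<close> in the radial derivative cancels the \<open>- 1\<close> in the exponent of
    \<open>h\<close>.\<close>
  define W where "W x = complex_of_real (N x powr - (\<alpha> / p))" for x
  have W: "continuous_on (- {0}) W"
    unfolding W_def by (intro continuous_on_of_real continuous_on_quasi_norm_powr)
  have g: "g x = f x * W x" for x
    by (simp add: g_def W_def powr_minus divide_inverse)
  have h: "h x = Ef x * W x" for x
  proof (cases "x = 0")
    \<comment> \<open>At the origin \<open>h\<close> is 0 because its denominator is 0 and division
      by 0 gives 0; the other side is 0 because the origin lies outside \<open>K\<close>.\<close>
    case True
    then show ?thesis
      by (simp add: h_def Ef_outside zero_notin_K quasi_norm_eq_0_iff)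
  next
    case False
    then show ?thesis
      using quasi_norm_pos[OF False]
      by (simp add: h_def W_def radial_deriv_eq powr_diff powr_minus field_simps)
  qed
  have g_cont: "continuous_on UNIV g" and h_cont: "continuous_on UNIV h"
    unfolding g[abs_def] h[abs_def]
    by (rule continuous_on_mult_vanishing_near_0[OF _ W compact_imp_closed[OF compact_K] zero_notin_K];
        simp add: continuous_f continuous_Ef f_outside Ef_outside)+
  have int: "integrable lborel (\<lambda>x. cmod (g x) powr p)" "integrable lborel (\<lambda>x. cmod (h x) powr p)"
    by (intro integrable_continuous_compact_support[OF _ compact_K] continuous_on_norm_powr
        g_cont h_cont; use p in \<open>simp add: g h f_outside Ef_outside\<close>)+
  define D where "D x = cmod (f x) powr (p - 2) * Re (f x * cnj (Ef x)) * N x powr - \<alpha>" for x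
  have W_powr: "cmod (W x) powr q = N x powr (- \<alpha> * q / p)" for x q
    by (simp add: W_def powr_powr)
  have gp: "cmod (g x) powr p = cmod (f x) powr p * N x powr - \<alpha>" for x
    using p by (simp add: g norm_mult powr_mult W_powr)
  \<comment> \<open>The weights combine to \<open>cmod (W x) powr p\<close>, which is
    \<open>N x powr - \<alpha>\<close>, so the mixed term is the integrand of the scaling
    identity.\<close>
  have D: "cmod (g x) powr (p - 2) * Re (g x * cnj (h x)) = D x" for x
  proof (cases "x = 0")
    case True
    then show ?thesis by (simp add: D_def g h f_outside zero_notin_K)
  next
    case False
    have "g x * cnj (h x) = of_real ((cmod (W x))\<^sup>2) * (f x * cnj (Ef x))"
      by (simp add: g h W_def power2_eq_square)
    then have "Re (g x * cnj (h x)) = (cmod (W x))\<^sup>2 * Re (f x * cnj (Ef x))"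
      by (simp only: Re_complex_of_real Im_complex_of_real times_complex.sel)
    then have "cmod (g x) powr (p - 2) * Re (g x * cnj (h x))
      = cmod (f x) powr (p - 2) * Re (f x * cnj (Ef x)) * (cmod (W x) powr (p - 2) * (cmod (W x))\<^sup>2)"
      by (simp only: g norm_mult powr_mult norm_ge_zero mult_ac)
    also have "cmod (W x) powr (p - 2) * (cmod (W x))\<^sup>2 = N x powr - \<alpha>"
    proof -
      have "cmod (W x) powr (p - 2) * (cmod (W x))\<^sup>2 = cmod (W x) powr p"
        using quasi_norm_pos[OF False] powr_add[of "cmod (W x)" "p - 2" 2]
        by (simp add: W_def powr_numeral)
      then show ?thesis using p by (simp add: W_powr)
    qed
    finally show ?thesis by (simp add: D_def)
  qed
  note euler = integrable_integral_euler[OF p, of \<alpha>, folded D_def]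
  have Cp: "Cp p (h x) (h x + of_real c * g x) = cmod (h x) powr p
      + ((p - 1) * \<bar>c\<bar> powr p) * cmod (g x) powr p + (p * c * \<bar>c\<bar> powr (p - 2)) * D x" for x
    by (simp only: Cp_eq[OF p] D)
  show Cp_int: "integrable lborel (\<lambda>x. Cp p (h x) (h x + of_real c * g x))"
    unfolding Cp using int euler(1) by (intro Bochner_Integration.integrable_add integrable_mult_right)
  let ?G = "\<integral>x. cmod (g x) powr p \<partial>lborel"
  have Cp_integral: "(\<integral>x. Cp p (h x) (h x + of_real c * g x) \<partial>lborel) = (\<integral>x. cmod (h x) powr p \<partial>lborel)
      + ((p - 1) * \<bar>c\<bar> powr p) * ?G + (p * c * \<bar>c\<bar> powr (p - 2)) * (\<integral>x. D x \<partial>lborel)"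
    unfolding Cp using int euler(1) by simp
  have D_integral: "(\<integral>x. D x \<partial>lborel) = - c * ?G"
    using euler(2) p unfolding gp c_def by (simp add: field_simps)
  have "c * \<bar>c\<bar> powr (p - 2) * c = \<bar>c\<bar> powr p"
    using powr_add[of "\<bar>c\<bar>" "p - 2" 2] by (cases "c = 0") (auto simp: powr_numeral power2_eq_square)
  then have coeff: "(p * c * \<bar>c\<bar> powr (p - 2)) * (- c * ?G) = - p * \<bar>c\<bar> powr p * ?G"
    by (metis (no_types, lifting) mult.assoc mult.commute mult_minus_left)
  show "\<bar>c\<bar> powr p * ?G
      = (\<integral>x. cmod (h x) powr p \<partial>lborel) - (\<integral>x. Cp p (h x) (h x + of_real c * g x) \<partial>lborel)"
    unfolding Cp_integral D_integral coeff by (simp add: algebra_simps)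
  assume zero: "(\<integral>x. Cp p (h x) (h x + of_real c * g x) \<partial>lborel) = 0" and t: "0 < t"
  \<comment> \<open>A nonnegative integrand with zero integral vanishes almost everywhere, which
    forces \<open>h + c * g = 0\<close> there; continuity of \<open>h\<close> and \<open>g\<close>
    extends this to every point.\<close>
  then have "AE x in lborel. Cp p (h x) (h x + of_real c * g x) = 0"
    using integral_nonneg_eq_0_iff_AE[OF Cp_int] Cp_nonneg[OF p] by simp
  then have "AE x in lborel. h x + of_real c * g x = 0"
    by (simp add: Cp_eq_0_iff[OF p])
  then have hg: "h x + of_real c * g x = 0" for x
    by (rule continuous_AE_lborel_zero[rotated]) (intro continuous_intros g_cont h_cont)
  have Ef: "Ef x = - of_real c * f x" for x
  proof (cases "x = 0")
    case False
    then have "W x \<noteq> 0"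
      using quasi_norm_pos[OF False] by (simp add: W_def)
    moreover have "(Ef x + of_real c * f x) * W x = 0"
      using hg[of x] by (simp add: g h algebra_simps)
    ultimately show ?thesis by (simp add: add_eq_0_iff2)
  qed (simp add: f_outside Ef_outside zero_notin_K)
  \<comment> \<open>By the Euler equation the two terms of the product rule cancel, so the product
    is constant on each orbit; its value at \<open>r = 1\<close> is \<open>f x\<close>.\<close>
  have "((\<lambda>r. r powr c *\<^sub>R f (\<delta> r x)) has_vector_derivative 0) (at r within {0<..})"
    if "0 < r" for r
  proof -
    have "((\<lambda>r. r powr c) has_real_derivative c * r powr (c - 1)) (at r)"
      using that by (auto intro!: derivative_eq_intros simp: powr_diff)
    from has_vector_derivative_scaleR[OF this has_vector_derivative_f_hdil[OF that, of x]]
    have "((\<lambda>r. r powr c *\<^sub>R f (\<delta> r x)) has_vector_derivative 0) (at r)"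
      using that by (simp add: Ef powr_diff scaleR_conv_of_real)
    then show ?thesis by (rule has_vector_derivative_at_within)
  qed
  then obtain k where k: "\<And>r. 0 < r \<Longrightarrow> r powr c *\<^sub>R f (\<delta> r x) = k"
    using has_vector_derivative_zero_constant[of "{0<..}" "\<lambda>r. r powr c *\<^sub>R f (\<delta> r x)"] by auto
  show "of_real (t powr c) * f (\<delta> t x) = f x"
    using k[OF t] k[of 1] by (simp add: scaleR_conv_of_real)
qed

text \<open>A nonzero \<open>x\<close> can be dilated out of the compact support; homogeneity
  carries the zero found there back to \<open>x\<close>.\<close>

lemma homogeneous_imp_zero:
  assumes "\<And>t x. 0 < t \<Longrightarrow> of_real (t powr c) * f (\<delta> t x) = f x"
  shows "f x = 0"
proof (cases "x = 0")
  case False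
  have "bounded (N ` K)"
    by (intro compact_imp_bounded compact_continuous_image continuous_quasi_norm compact_K)
  then obtain B where B: "\<And>y. y \<in> K \<Longrightarrow> \<bar>N y\<bar> \<le> B"
    by (auto simp: bounded_iff)
  \<comment> \<open>This factor gives \<open>\<delta> t x\<close> the quasi-norm
    \<open>|B| + 1\<close>, beyond all values on \<open>K\<close>; the absolute value keeps it
    positive even if \<open>K\<close> is empty.\<close>
  define t where "t = (\<bar>B\<bar> + 1) / N x"
  have t: "0 < t" "t * N x = \<bar>B\<bar> + 1"
    using quasi_norm_pos[OF False] by (auto simp: t_def)
  then have "\<delta> t x \<notin> K"
    using B[of "\<delta> t x"] by (auto simp: quasi_norm_hdil)
  then show ?thesis
    using assms[OF t(1), of x] by (simp add: f_outside)
qed (simp add: f_outside zero_notin_K)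

end

theorem theorem3p3:
  fixes mul :: "real^'n \<Rightarrow> real^'n \<Rightarrow> real^'n" and P :: "real^'n^'n" and \<nu> :: "real^'n"
    and N :: "real^'n \<Rightarrow> real" and p \<alpha> :: real and f :: "real^'n \<Rightarrow> complex"
  assumes G: "homogeneous_group mul P \<nu>"
    and qn: "homogeneous_quasi_norm P \<nu> N"
    and p: "1 < p"
    and f: "f \<in> C0inf_punct"
  defines "Q \<equiv> hom_dim \<nu>"
  defines "g \<equiv> (\<lambda>x. f x / of_real (N x powr (\<alpha> / p)))"
  defines "h \<equiv> (\<lambda>x. radial_deriv P \<nu> N f x / of_real (N x powr (\<alpha> / p - 1)))"
  shows "\<bar>(Q - \<alpha>) / p\<bar> powr p * (\<integral>x. cmod (g x) powr p \<partial>lborel)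
           = (\<integral>x. cmod (h x) powr p \<partial>lborel)
             - (\<integral>x. Cp p (h x) (h x + of_real ((Q - \<alpha>) / p) * g x) \<partial>lborel)
         \<and> \<bar>(Q - \<alpha>) / p\<bar> powr p * (\<integral>x. cmod (g x) powr p \<partial>lborel)
           \<le> (\<integral>x. cmod (h x) powr p \<partial>lborel)
         \<and> (p \<ge> 2 \<longrightarrow> (\<integral>x. Cp p (h x) (h x + of_real ((Q - \<alpha>) / p) * g x) \<partial>lborel) = 0 \<longrightarrow>
             (\<exists>\<phi>. \<forall>x. x \<noteq> 0 \<longrightarrow>
                f x = of_real (N x powr (- (Q - \<alpha>) / p)) * \<phi> (hdil P \<nu> (1 / N x) x)))
         \<and> (p \<ge> 2 \<longrightarrow> (\<exists>x. f x \<noteq> 0) \<longrightarrow>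
             \<bar>(Q - \<alpha>) / p\<bar> powr p * (\<integral>x. cmod (g x) powr p \<partial>lborel)
             < (\<integral>x. cmod (h x) powr p \<partial>lborel))"
proof -
  interpret punctured_test_function P \<nu> N f
    using G qn f by unfold_locales (auto simp: homogeneous_group_def)
  let ?c = "(Q - \<alpha>) / p"
  let ?C = "\<integral>x. Cp p (h x) (h x + of_real ?c * g x) \<partial>lborel"
  have identity: "\<bar>?c\<bar> powr p * (\<integral>x. cmod (g x) powr p \<partial>lborel) = (\<integral>x. cmod (h x) powr p \<partial>lborel) - ?C"
    unfolding Q_def g_def h_def by (rule hardy_identity(2)[OF p])
  have homogeneous: "of_real (t powr ?c) * f (\<delta> t x) = f x" if "?C = 0" "0 < t" for t x
    using that unfolding Q_def g_def h_def by (rule hardy_identity(3)[OF p])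
  \<comment> \<open>With the identity, this sign is the inequality.\<close>
  have C_nonneg: "0 \<le> ?C"
    by (rule integral_nonneg_AE) (simp add: Cp_nonneg[OF p])
  have zero: "f x = 0" if "?C = 0" for x
    using homogeneous[OF that] by (rule homogeneous_imp_zero)
  \<comment> \<open>A zero remainder would make \<open>f\<close> homogeneous and hence zero, so a
    nonzero \<open>f\<close> has a positive remainder.\<close>
  have strict: "0 < ?C" if "f x \<noteq> 0" for x
    using C_nonneg zero[of x] that by (cases "?C = 0") auto
  \<comment> \<open>The profile \<open>\<phi>\<close> is \<open>f\<close> itself: homogeneity is
    applied with factor \<open>N x\<close> at the point \<open>hdil P \<nu> (1 / N x) x\<close> of
    the unit sphere.\<close>
  have "f x = of_real (N x powr (- (Q - \<alpha>) / p)) * f (hdil P \<nu> (1 / N x) x)"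
    if "?C = 0" "x \<noteq> 0" for x
  proof -
    have "of_real (N x powr ?c) * f x = f (hdil P \<nu> (1 / N x) x)"
      using homogeneous[OF that(1) quasi_norm_pos[OF that(2)], of "hdil P \<nu> (1 / N x) x"]
        quasi_norm_pos[OF that(2)] by (simp add: hdil_inverse)
    moreover have "N x powr (- (Q - \<alpha>) / p) * N x powr ?c = 1"
      using quasi_norm_pos[OF that(2)] by (simp add: powr_add[symmetric] add_divide_distrib[symmetric])
    then have "complex_of_real (N x powr (- (Q - \<alpha>) / p)) * of_real (N x powr ?c) = 1"
      by (metis of_real_1 of_real_mult)
    ultimately show ?thesis
      by (metis mult.assoc mult_1)
  qed
  with identity C_nonneg strict show ?thesis
    by (intro conjI impI) (auto intro!: exI[of _ f])
qed

end
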